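(* Let $k,n_1,\dots,n_k,q\ge 2$ be integers. Then the number $l_{\ge q}(n_1,\dots,n_k)$ of lines in $\mathbb{R}^k$ passing through at least $q$ points of the grid $G(n_1,\dots,n_k)$ satisfies \[ l_{\ge q}(n_1,\dots,n_k)=\frac12\bigl(f_{q-1}(n_1,\dots,n_k)-f_q(n_1,\dots,n_k)\bigr). \]
   Context: For integers $k,n_1,\dots,n_k\ge 2$, let $G(n_1,\dots,n_k)=\{0,\dots,n_1-1\}\times\dots\times\{0,\dots,n_k-1\}\subset\mathbb{R}^k$. For an integer $q\ge 1$, \[ f_q(n_1,\dots,n_k)=\sum_{\substack{-n_1<i_1<n_1,\ \dots,\ -n_k<i_k<n_k\\ \gcd(i_1,\dots,i_k)=q}}(n_1-|i_1|)\cdots(n_k-|i_k|), \] the sum being over integer tuples $(i_1,\dots,i_k)$. The gcd of integers is taken to be nonnegative, with $\gcd(0,\dots,0)=0$. *)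

theory Defs
  imports "HOL-Analysis.Analysis"
begin

text \<open>
  The dimension \<open>k\<close> is the cardinality of the finite index type \<open>'k\<close>, and the side lengths
  \<open>n\<^sub>1, \<dots>, n\<^sub>k\<close> are a function \<open>n :: 'k \<Rightarrow> nat\<close>.
\<close>

definition grid :: "('k::finite \<Rightarrow> nat) \<Rightarrow> (real^'k) set" where
  "grid n = {x. \<forall>j. \<exists>m<n j. x $ j = real m}"

text \<open>On \<open>int\<close>, \<open>Gcd\<close> is nonnegative and \<open>Gcd {0} = 0\<close>.\<close>

definition gcd_sum :: "nat \<Rightarrow> ('k::finite \<Rightarrow> nat) \<Rightarrow> int" where
  "gcd_sum q n =
     (\<Sum>i | (\<forall>j. - int (n j) < i j \<and> i j < int (n j)) \<and> Gcd (range i) = int q.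
        \<Prod>j\<in>UNIV. (int (n j) - \<bar>i j\<bar>))"

text \<open>
  For \<open>q \<ge> 2\<close> only finitely many lines qualify, since each is determined by two of the finitely many
  grid points; hence \<open>card\<close> does count them.
\<close>

definition num_lines_ge :: "nat \<Rightarrow> ('k::finite \<Rightarrow> nat) \<Rightarrow> nat" where
  "num_lines_ge q n =
     card {L :: (real^'k) set. affine L \<and> aff_dim L = 1 \<and> card (L \<inter> grid n) \<ge> q}"

end

theory Submission
  imports Defs
begin

text \<open>
  Since \<open>n\<^sub>j - \<bar>i\<^sub>j\<bar>\<close> counts the positions of a step \<open>i\<^sub>j\<close> inside \<open>{0, \<dots>, n\<^sub>j - 1}\<close>, writing
  \<open>i = d v\<close> with \<open>v\<close> primitive shows that \<open>f\<^sub>d\<close> is the number of pairs \<open>(x, v)\<close>, \<open>v\<close> primitive, such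
  that \<open>x\<close> and \<open>x + d v\<close> are grid points. By convexity of the box, these sets of pairs decrease in
  \<open>d\<close>, so \<open>f\<^sub>q\<^sub>-\<^sub>1 - f\<^sub>q\<close> counts the pairs for which \<open>x + (q - 1) v\<close> is the last grid point on the
  ray from \<open>x\<close> in direction \<open>v\<close>. The grid points of a line are equally spaced by a primitive vector
  \<open>w\<close>, so every line with at least \<open>q\<close> of them comes from exactly two such pairs, one for each of the
  directions \<open>w\<close> and \<open>-w\<close>.
\<close>

section \<open>Integer model of the grid\<close>

definition box_points :: "('k::finite \<Rightarrow> nat) \<Rightarrow> ('k \<Rightarrow> int) set" where
  "box_points n = {x. \<forall>j. 0 \<le> x j \<and> x j < int (n j)}"

text \<open>Bridge from integer functions, where divisibility and \<open>Gcd\<close> make sense, to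
  the real space containing the lines.\<close>

definition of_int_vec :: "('k::finite \<Rightarrow> int) \<Rightarrow> real^'k" where
  "of_int_vec x = (\<chi> j. real_of_int (x j))"

definition steps :: "nat \<Rightarrow> ('k::finite \<Rightarrow> nat) \<Rightarrow> (('k \<Rightarrow> int) \<times> ('k \<Rightarrow> int)) set" where
  "steps d n = {(x, v). Gcd (range v) = 1 \<and> x \<in> box_points n \<and> (\<lambda>j. x j + int d * v j) \<in> box_points n}"

definition line_through :: "('k::finite \<Rightarrow> int) \<Rightarrow> ('k \<Rightarrow> int) \<Rightarrow> (real^'k) set" where
  "line_through x v = affine hull {of_int_vec x, of_int_vec (\<lambda>j. x j + v j)}"

lemma of_int_vec_nth [simp]: "of_int_vec x $ j = real_of_int (x j)"
  by (simp add: of_int_vec_def)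

lemma inj_of_int_vec: "inj of_int_vec"
  by (auto simp: inj_def vec_eq_iff)

lemma grid_eq_image: "grid n = of_int_vec ` box_points n"
proof (intro set_eqI iffI)
  fix x assume "x \<in> grid n"
  then obtain m where m: "\<And>j. m j < n j \<and> x $ j = real (m j)"
    unfolding grid_def mem_Collect_eq by metis
  have "x = of_int_vec (\<lambda>j. int (m j))" using m by (simp add: vec_eq_iff)
  moreover have "(\<lambda>j. int (m j)) \<in> box_points n" using m by (simp add: box_points_def)
  ultimately show "x \<in> of_int_vec ` box_points n" by blast
next
  fix x assume "x \<in> of_int_vec ` box_points n"
  then obtain y where y: "x = of_int_vec y" "\<And>j. 0 \<le> y j \<and> y j < int (n j)"
    by (auto simp: box_points_def)
  have "nat (y j) < n j \<and> x $ j = real (nat (y j))" for j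
    using y(1) y(2)[of j] by auto
  then show "x \<in> grid n" by (auto simp: grid_def)
qed

lemma box_points_eq_PiE: "box_points n = (\<Pi>\<^sub>E j\<in>UNIV. {0..<int (n j)})"
  by (auto simp: box_points_def PiE_def Pi_def)

lemma finite_box_points [simp]: "finite (box_points n)"
  unfolding box_points_eq_PiE by (rule finite_PiE) auto

section \<open>Gcd sums as numbers of steps\<close>

lemma card_box_translates:
  assumes "\<And>j. \<bar>i j\<bar> < int (n j)"
  shows "int (card {x \<in> box_points n. (\<lambda>j. x j + i j) \<in> box_points n})
    = (\<Prod>j\<in>UNIV. int (n j) - \<bar>i j\<bar>)"
proof -
  have eq: "{x \<in> box_points n. (\<lambda>j. x j + i j) \<in> box_points n}
     = (\<Pi>\<^sub>E j\<in>UNIV. {max 0 (- i j)..<min (int (n j)) (int (n j) - i j)})"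
    by (auto simp: box_points_def PiE_def Pi_def) (smt (verit))+
  \<comment> \<open>The bound on \<open>i j\<close> makes this interval length positive, so
    \<open>nat\<close> truncates nothing.\<close>
  have "int (nat (min (int (n j)) (int (n j) - i j) - max 0 (- i j))) = int (n j) - \<bar>i j\<bar>" for j
    using assms[of j] by auto
  then show ?thesis
    unfolding eq by (subst card_PiE) auto
qed

lemma Gcd_range_mult: "Gcd (range (\<lambda>j. c * v j)) = \<bar>c\<bar> * Gcd (range v)" for c :: int
proof -
  have "range (\<lambda>j. c * v j) = (*) c ` range v" by auto
  then show ?thesis by (simp add: Gcd_mult abs_mult)
qed

text \<open>Divide by the gcd: by \<open>Gcd_range_mult\<close> the gcd of \<open>i\<close> is
  itself times the gcd of the quotients, and being nonzero it cancels.\<close>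

lemma primitive_direction:
  fixes i :: "'a \<Rightarrow> int"
  assumes "i \<noteq> (\<lambda>_. 0)"
  obtains v where "Gcd (range v) = 1" "Gcd (range i) > 0" "\<And>j. i j = Gcd (range i) * v j"
proof -
  let ?d = "Gcd (range i)"
  have "?d \<noteq> 0" using assms by (auto simp: Gcd_0_iff)
  then have d: "?d > 0" by (metis Gcd_int_greater_eq_0 order_le_less)
  have v: "i j = ?d * (i j div ?d)" for j by (simp add: Gcd_dvd)
  have "?d = \<bar>?d\<bar> * Gcd (range (\<lambda>j. i j div ?d))"
    using Gcd_range_mult[of ?d "\<lambda>j. i j div ?d"] v by simp
  then have "Gcd (range (\<lambda>j. i j div ?d)) = 1"
    using \<open>?d \<noteq> 0\<close> d by (simp del: Gcd_0_iff)
  with d v show ?thesis by (intro that) auto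
qed

text \<open>Groups the steps by displacement \<open>i = d v\<close>, so that each fibre is a set
  counted by \<open>card_box_translates\<close>. As \<open>d\<close> is nonzero, \<open>i\<close>
  determines \<open>v\<close>.\<close>

lemma bij_betw_steps:
  assumes "d \<ge> 1"
  shows "bij_betw (\<lambda>(x, v). (\<lambda>j. int d * v j, x)) (steps d n)
    (SIGMA i : {i. (\<forall>j. - int (n j) < i j \<and> i j < int (n j)) \<and> Gcd (range i) = int d}.
       {x \<in> box_points n. (\<lambda>j. x j + i j) \<in> box_points n})"
    (is "bij_betw ?f _ ?T")
  unfolding bij_betw_def
proof
  show "inj_on ?f (steps d n)"
    using assms by (auto simp: inj_on_def fun_eq_iff)
  show "?f ` steps d n = ?T"
  proof (intro set_eqI iffI)
    fix z assume "z \<in> ?f ` steps d n"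
    then obtain x v where z: "z = (\<lambda>j. int d * v j, x)" "Gcd (range v) = 1"
      "x \<in> box_points n" "(\<lambda>j. x j + int d * v j) \<in> box_points n"
      by (auto simp: steps_def)
    have "- int (n j) < int d * v j \<and> int d * v j < int (n j)" for j
      using z(3,4) unfolding box_points_def by (auto dest!: spec[of _ j])
    with z show "z \<in> ?T" by (auto simp: Gcd_range_mult)
  next
    fix z assume "z \<in> ?T"
    then obtain i x where z: "z = (i, x)" "Gcd (range i) = int d"
      "x \<in> box_points n" "(\<lambda>j. x j + i j) \<in> box_points n" by auto
    have "i \<noteq> (\<lambda>_. 0)" using z(2) assms by auto
    then obtain v where v: "Gcd (range v) = 1" "\<And>j. i j = int d * v j"
      using primitive_direction[of i] z(2) by metis
    have "(x, v) \<in> steps d n" using z v by (simp add: steps_def)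
    moreover have "?f (x, v) = z" using z v by (simp add: fun_eq_iff)
    ultimately show "z \<in> ?f ` steps d n" by (metis image_eqI)
  qed
qed

lemma
  assumes "d \<ge> 1"
  shows finite_steps: "finite (steps d n)"
    and gcd_sum_eq_card_steps: "gcd_sum d n = int (card (steps d n))"
proof -
  let ?I = "{i. (\<forall>j. - int (n j) < i j \<and> i j < int (n j)) \<and> Gcd (range i) = int d}"
  let ?X = "\<lambda>i. {x \<in> box_points n. (\<lambda>j. x j + i j) \<in> box_points n}"
  have "?I \<subseteq> (\<Pi>\<^sub>E j\<in>UNIV. {- int (n j)<..<int (n j)})" by (auto simp: PiE_def)
  moreover have "finite (\<Pi>\<^sub>E j\<in>UNIV. {- int (n j)<..<int (n j)})" by (rule finite_PiE) auto
  ultimately have fin: "finite ?I" by (rule finite_subset)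
  then show "finite (steps d n)"
    using bij_betw_finite[OF bij_betw_steps[OF assms, of n]] by (simp add: finite_SigmaI)
  have "gcd_sum d n = (\<Sum>i\<in>?I. int (card (?X i)))"
    unfolding gcd_sum_def by (intro sum.cong refl card_box_translates[symmetric]) (auto simp: abs_less_iff minus_less_iff)
  also have "\<dots> = int (card (Sigma ?I ?X))" using fin by (simp add: card_SigmaI)
  also have "\<dots> = int (card (steps d n))"
    using bij_betw_same_card[OF bij_betw_steps[OF assms, of n]] by simp
  finally show "gcd_sum d n = int (card (steps d n))" .
qed

text \<open>Each coordinate is monotone in the parameter, in a direction given by the sign of
  \<open>v j\<close>, so its value at \<open>u\<close> lies between those at \<open>s\<close> and
  \<open>t\<close>.\<close>

lemma box_points_convex:
  assumes "(\<lambda>j. x j + s * v j) \<in> box_points n" "(\<lambda>j. x j + t * v j) \<in> box_points n"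
    and "s \<le> u" "u \<le> t"
  shows "(\<lambda>j. x j + u * v j) \<in> box_points n"
proof -
  have "0 \<le> x j + u * v j \<and> x j + u * v j < int (n j)" for j
  proof -
    have b: "0 \<le> x j + s * v j" "x j + s * v j < int (n j)"
      "0 \<le> x j + t * v j" "x j + t * v j < int (n j)"
      using assms(1,2) by (auto simp: box_points_def)
    show ?thesis
    proof (cases "v j \<ge> 0")
      case True
      then show ?thesis
        using b mult_right_mono[OF assms(3) True] mult_right_mono[OF assms(4) True] by linarith
    next
      case False
      then have "v j \<le> 0" by simp
      then show ?thesis
        using b mult_right_mono_neg[OF assms(3)] mult_right_mono_neg[OF assms(4)] by (smt (verit))
    qed
  qed
  then show ?thesis by (simp add: box_points_def)
qed

text \<open>Makes the difference of two consecutive gcd sums the size of a set difference.\<close>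

lemma steps_Suc_subset: "steps (Suc d) n \<subseteq> steps d n"
  unfolding steps_def
  using box_points_convex[where s = 0 and t = "int (Suc d)" and u = "int d"] by fastforce

section \<open>Lattice points on a line\<close>

text \<open>Primitivity of \<open>v\<close> forces the real parameter of a lattice point on the line
  to be an integer.\<close>

lemma of_int_vec_in_line_iff:
  assumes "Gcd (range v) = 1"
  shows "of_int_vec z \<in> line_through x v \<longleftrightarrow> (\<exists>t. z = (\<lambda>j. x j + t * v j))"
proof
  assume "of_int_vec z \<in> line_through x v"
  then obtain u where
    "of_int_vec z = of_int_vec x + u *\<^sub>R (of_int_vec (\<lambda>j. x j + v j) - of_int_vec x)"
    by (auto simp: line_through_def affine_hull_2_alt)
  then have u: "real_of_int (z j - x j) = u * real_of_int (v j)" for j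
    by (simp add: vec_eq_iff)
  obtain k where k: "v k \<noteq> 0"
    using assms by (metis Gcd_0_iff image_subset_iff singletonI zero_neq_one)
  \<comment> \<open>Eliminates the real parameter: both sides equal
    \<open>u * v k * v j\<close>.\<close>
  have cross: "v k * (z j - x j) = (z k - x k) * v j" for j
  proof -
    have "real_of_int (v k * (z j - x j)) = real_of_int ((z k - x k) * v j)"
      unfolding of_int_mult u by simp
    then show ?thesis by linarith
  qed
  \<comment> \<open>Since \<open>v\<close> is primitive, this gcd is the absolute value of
    \<open>z k - x k\<close>.\<close>
  have "v k dvd Gcd (range (\<lambda>j. (z k - x k) * v j))"
    by (rule Gcd_greatest) (auto simp: cross[symmetric])
  then have "v k dvd z k - x k" by (simp add: Gcd_range_mult assms)
  then obtain t where t: "z k - x k = v k * t" by (elim dvdE)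
  have "z j = x j + t * v j" for j
    using cross[of j] k unfolding t by simp
  then show "\<exists>t. z = (\<lambda>j. x j + t * v j)" by blast
next
  assume "\<exists>t. z = (\<lambda>j. x j + t * v j)"
  then obtain t where "z = (\<lambda>j. x j + t * v j)" ..
  then have "of_int_vec z
      = of_int_vec x + real_of_int t *\<^sub>R (of_int_vec (\<lambda>j. x j + v j) - of_int_vec x)"
    by (simp add: vec_eq_iff)
  then show "of_int_vec z \<in> line_through x v"
    by (auto simp: line_through_def affine_hull_2_alt)
qed

text \<open>The hull of two distinct points of \<open>L\<close> lies in \<open>L\<close> and has the
  same dimension.\<close>

lemma line_through_eqI:
  assumes "affine L" "aff_dim L = 1" "of_int_vec x \<in> L" "of_int_vec (\<lambda>j. x j + v j) \<in> L"
    and "v \<noteq> (\<lambda>_. 0)"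
  shows "line_through x v = L"
proof -
  have "of_int_vec x \<noteq> of_int_vec (\<lambda>j. x j + v j)"
    using assms(5) by (auto simp: vec_eq_iff fun_eq_iff)
  then have "aff_dim (line_through x v) = 1"
    by (simp add: line_through_def aff_dim_affine_hull aff_dim_2)
  moreover have "line_through x v \<subseteq> L"
    unfolding line_through_def using assms by (intro hull_minimal) auto
  moreover have "line_through x v \<noteq> {}" by (simp add: line_through_def)
  ultimately show ?thesis
    using assms(1,2) by (intro affine_dim_equal) (auto simp: line_through_def)
qed

lemma primitive_nonzero: "Gcd (range v) = (1::int) \<Longrightarrow> v \<noteq> (\<lambda>_. 0)"
  by auto

lemma
  assumes "Gcd (range v) = 1"
  shows affine_line_through: "affine (line_through x v)"
    and aff_dim_line_through: "aff_dim (line_through x v) = 1"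
proof -
  have "of_int_vec x \<noteq> of_int_vec (\<lambda>j. x j + v j)"
    using primitive_nonzero[OF assms] by (auto simp: vec_eq_iff fun_eq_iff)
  then show "aff_dim (line_through x v) = 1"
    by (simp add: line_through_def aff_dim_affine_hull aff_dim_2)
qed (simp add: line_through_def)

lemma inj_parametrization:
  fixes v :: "'a \<Rightarrow> int"
  assumes "Gcd (range v) = 1"
  shows "inj (\<lambda>t j. x j + t * v j)"
  using primitive_nonzero[OF assms] by (auto simp: inj_def fun_eq_iff)

lemma card_line_through_grid:
  assumes "Gcd (range v) = 1"
  shows "finite {t. (\<lambda>j. x j + t * v j) \<in> box_points n}"
    and "card (line_through x v \<inter> grid n) = card {t. (\<lambda>j. x j + t * v j) \<in> box_points n}"
proof -
  let ?T = "{t. (\<lambda>j. x j + t * v j) \<in> box_points n}"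
  let ?g = "\<lambda>t j. x j + t * v j"
  have "finite (?g -` box_points n)"
    by (rule finite_vimageI) (simp_all add: inj_parametrization[OF assms])
  then show "finite ?T" by (simp add: vimage_def)
  have "line_through x v \<inter> grid n = of_int_vec ` ?g ` ?T"
    unfolding grid_eq_image by (auto simp: of_int_vec_in_line_iff[OF assms])
  then show "card (line_through x v \<inter> grid n) = card ?T"
    by (simp add: card_image inj_on_subset[OF inj_of_int_vec subset_UNIV]
        inj_on_subset[OF inj_parametrization[OF assms] subset_UNIV])
qed

text \<open>On a common line, \<open>v\<close> is an integer multiple of \<open>w\<close>; both
  being primitive, the factor is 1 or -1.\<close>

lemma line_through_eq_iff:
  assumes "Gcd (range v) = 1" "Gcd (range w) = 1"
  shows "line_through x v = line_through p w \<longleftrightarrow>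
    (\<exists>t. x = (\<lambda>j. p j + t * w j)) \<and> (v = w \<or> v = (\<lambda>j. - w j))"
proof
  assume eq: "line_through x v = line_through p w"
  have "of_int_vec x \<in> line_through p w" "of_int_vec (\<lambda>j. x j + v j) \<in> line_through p w"
    unfolding eq[symmetric] of_int_vec_in_line_iff[OF assms(1)]
    by (auto intro: exI[of _ 0] exI[of _ 1])
  then obtain s t where t: "x = (\<lambda>j. p j + t * w j)" and s: "(\<lambda>j. x j + v j) = (\<lambda>j. p j + s * w j)"
    unfolding of_int_vec_in_line_iff[OF assms(2)] by blast
  have v: "v = (\<lambda>j. (s - t) * w j)"
    using s unfolding t by (auto simp: fun_eq_iff algebra_simps)
  then have "\<bar>s - t\<bar> = 1"
    using Gcd_range_mult[of "s - t" w] assms by simp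
  then have "s - t = 1 \<or> s - t = -1" by linarith
  with t v show "(\<exists>t. x = (\<lambda>j. p j + t * w j)) \<and> (v = w \<or> v = (\<lambda>j. - w j))" by auto
next
  assume r: "(\<exists>t. x = (\<lambda>j. p j + t * w j)) \<and> (v = w \<or> v = (\<lambda>j. - w j))"
  then obtain t where t: "x = (\<lambda>j. p j + t * w j)" by blast
  have "(\<lambda>j. x j + v j) = (\<lambda>j. p j + (t + 1) * w j) \<or> (\<lambda>j. x j + v j) = (\<lambda>j. p j + (t - 1) * w j)"
    using r by (auto simp: t fun_eq_iff algebra_simps)
  then show "line_through x v = line_through p w"
    using t assms primitive_nonzero[OF assms(1)]
    by (intro line_through_eqI affine_line_through aff_dim_line_through)
       (auto simp: of_int_vec_in_line_iff)
qed

section \<open>Lines with many grid points\<close>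

definition rich_lines :: "nat \<Rightarrow> ('k::finite \<Rightarrow> nat) \<Rightarrow> (real^'k) set set" where
  "rich_lines q n = {L. affine L \<and> aff_dim L = 1 \<and> card (L \<inter> grid n) \<ge> q}"

text \<open>Two distinct grid points on \<open>L\<close> span it; dividing their difference by its
  gcd gives a primitive direction.\<close>

lemma rich_line_parametrization:
  assumes "L \<in> rich_lines q n" "q \<ge> 2"
  obtains p w where "Gcd (range w) = 1" "L = line_through p w"
proof -
  have L: "affine L" "aff_dim L = 1" "card (L \<inter> grid n) \<ge> 2"
    using assms by (auto simp: rich_lines_def)
  obtain x y where xy: "of_int_vec x \<in> L" "of_int_vec y \<in> L" "x \<noteq> y"
  proof -
    obtain X where "X \<subseteq> L \<inter> grid n" "card X = 2"
      using L(3) obtain_subset_with_card_n by metis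
    then obtain a b where "a \<in> L \<inter> grid n" "b \<in> L \<inter> grid n" "a \<noteq> b"
      by (auto simp: card_2_iff)
    then show ?thesis unfolding grid_eq_image using that by auto
  qed
  have nz: "(\<lambda>j. y j - x j) \<noteq> (\<lambda>_. 0)" using xy(3) by (metis eq_iff_diff_eq_0 ext)
  define d where "d = Gcd (range (\<lambda>j. y j - x j))"
  obtain v where v: "Gcd (range v) = 1" "\<And>j. y j - x j = d * v j"
    using primitive_direction[OF nz] unfolding d_def by metis
  have "line_through x (\<lambda>j. y j - x j) = L"
    by (rule line_through_eqI) (use L xy nz in auto)
  moreover have "line_through x (\<lambda>j. y j - x j) = line_through x v"
  proof (rule line_through_eqI)
    have "y = (\<lambda>j. x j + d * v j)" using v(2) by (auto simp: fun_eq_iff algebra_simps)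
    then show "of_int_vec (\<lambda>j. x j + (y j - x j)) \<in> line_through x v"
      using of_int_vec_in_line_iff[OF v(1), of y x] by auto
    show "of_int_vec x \<in> line_through x v"
      unfolding of_int_vec_in_line_iff[OF v(1)] by (auto intro: exI[of _ 0])
  qed (use v nz affine_line_through aff_dim_line_through in auto)
  ultimately show ?thesis using that v(1) by metis
qed

lemma card_fibre:
  assumes "L \<in> rich_lines q n" "q \<ge> 2"
  shows "card {(x, v) \<in> steps (q - 1) n - steps q n. line_through x v = L} = 2"
proof -
  obtain p w where w: "Gcd (range w) = 1" and L: "L = line_through p w"
    using rich_line_parametrization[OF assms] .
  define T where "T = {t. (\<lambda>j. p j + t * w j) \<in> box_points n}"
  have T: "finite T" "card T \<ge> q"
    using card_line_through_grid[OF w, of p n] assms(1) unfolding T_def L rich_lines_def by auto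
  then have ne: "T \<noteq> {}" using assms(2) by auto
  define a b where "a = Min T" and "b = Max T"
  have "a \<in> T" "b \<in> T" unfolding a_def b_def using T ne by auto
  \<comment> \<open>By convexity the parameters of grid points have no gaps.\<close>
  then have "{a..b} \<subseteq> T" unfolding T_def using box_points_convex by fastforce
  moreover have "T \<subseteq> {a..b}" unfolding a_def b_def using T by auto
  ultimately have Tab: "T = {a..b}" by blast
  have mem: "(\<lambda>j. p j + t * w j) \<in> box_points n \<longleftrightarrow> a \<le> t \<and> t \<le> b" for t
    using Tab unfolding T_def by auto
  have len: "b - a + 1 \<ge> int q" using T(2) assms(2) unfolding Tab by simp
  define w' where "w' = (\<lambda>j. - w j)"
  have neg: "Gcd (range w') = 1" using Gcd_range_mult[of "-1" w] w by (simp add: w'_def)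
  define X where "X t = (\<lambda>j. p j + t * w j)" for t
  have mem_X: "X t \<in> box_points n \<longleftrightarrow> a \<le> t \<and> t \<le> b" for t
    using mem by (simp add: X_def)
  have plus: "(\<lambda>j. X t j + c * w j) = X (t + c)" for t c by (auto simp: X_def algebra_simps)
  have minus: "(\<lambda>j. X t j + c * w' j) = X (t - c)" for t c
    by (auto simp: X_def w'_def algebra_simps)
  \<comment> \<open>The parameter \<open>t + q - 1\<close> must be in range and \<open>t + q\<close>
    out of it, so \<open>t + q - 1 = b\<close>; \<open>len\<close> ensures that \<open>t\<close> is
    at least \<open>a\<close>.\<close>
  have fwd: "(X t, w) \<in> steps (q - 1) n - steps q n \<longleftrightarrow> t = b - int q + 1" for t
    unfolding steps_def using w len assms(2) by (auto simp: plus mem_X of_nat_diff)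
  \<comment> \<open>Mirror image: moving along \<open>w'\<close> lowers the parameter, so the walk
    ends at \<open>a\<close>.\<close>
  have bwd: "(X t, w') \<in> steps (q - 1) n - steps q n \<longleftrightarrow> t = a + int q - 1" for t
    unfolding steps_def using neg len assms(2) by (auto simp: minus mem_X of_nat_diff)
  have line: "line_through x v = L \<longleftrightarrow> (\<exists>t. x = X t) \<and> (v = w \<or> v = w')"
    if "Gcd (range v) = 1" for x v
    using line_through_eq_iff[OF that w] by (simp add: L X_def w'_def)
  have "{(x, v) \<in> steps (q - 1) n - steps q n. line_through x v = L}
    = {(X (b - int q + 1), w), (X (a + int q - 1), w')}" (is "?F = ?R")
  proof (intro set_eqI iffI)
    fix z assume "z \<in> ?F"
    then obtain x v where z: "z = (x, v)" and xv: "(x, v) \<in> steps (q - 1) n - steps q n"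
      "line_through x v = L" by blast
    then have "Gcd (range v) = 1" by (simp add: steps_def)
    from line[OF this] xv(2) obtain t where t: "x = X t" and v: "v = w \<or> v = w'" by blast
    from v show "z \<in> ?R"
    proof
      assume "v = w"
      then show ?thesis using xv(1) fwd[of t] unfolding z t by blast
    next
      assume "v = w'"
      then show ?thesis using xv(1) bwd[of t] unfolding z t by blast
    qed
  next
    fix z assume "z \<in> ?R"
    then show "z \<in> ?F"
      using fwd bwd line[OF w] line[OF neg] by blast
  qed
  \<comment> \<open>Keeps the two pairs distinct even if their base points coincide.\<close>
  moreover have "w \<noteq> w'"
    using primitive_nonzero[OF w] by (auto simp: w'_def fun_eq_iff)
  ultimately show ?thesis by simp
qed

text \<open>By convexity the parameters from 0 to \<open>q - 1\<close> all give grid points, which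
  are \<open>q\<close> in number.\<close>

lemma line_through_step_rich:
  assumes "(x, v) \<in> steps (q - 1) n" "q \<ge> 1"
  shows "line_through x v \<in> rich_lines q n"
proof -
  have v: "Gcd (range v) = 1" and x: "(\<lambda>j. x j + 0 * v j) \<in> box_points n"
    "(\<lambda>j. x j + int (q - 1) * v j) \<in> box_points n"
    using assms(1) by (auto simp: steps_def)
  have "{0..int (q - 1)} \<subseteq> {t. (\<lambda>j. x j + t * v j) \<in> box_points n}"
    using box_points_convex[OF x] by auto
  from card_mono[OF card_line_through_grid(1)[OF v] this]
  have "q \<le> card (line_through x v \<inter> grid n)"
    using assms(2) card_line_through_grid(2)[OF v, of x n] by simp
  then show ?thesis
    using affine_line_through[OF v] aff_dim_line_through[OF v] by (simp add: rich_lines_def)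
qed

theorem corollary1:
  fixes n :: "'k::finite \<Rightarrow> nat" and q :: nat
  assumes "CARD('k) \<ge> 2" and "\<And>j. n j \<ge> 2" and "q \<ge> 2"
  shows "real (num_lines_ge q n) = 1 / 2 * (real_of_int (gcd_sum (q - 1) n) - real_of_int (gcd_sum q n))"
proof -
  let ?D = "steps (q - 1) n - steps q n"
  let ?l = "\<lambda>(x, v). line_through x v"
  have sub: "steps q n \<subseteq> steps (q - 1) n"
    using steps_Suc_subset[of "q - 1" n] assms(3) by simp
  have fin: "finite ?D" using finite_steps[of "q - 1" n] assms(3) by simp
  have fibre: "card {z \<in> ?D. ?l z = L} = 2" if "L \<in> rich_lines q n" for L
    using card_fibre[OF that assms(3)] by (simp add: case_prod_beta' cong: conj_cong)
  have img: "?l ` ?D = rich_lines q n"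
  proof
    show "?l ` ?D \<subseteq> rich_lines q n" using line_through_step_rich assms(3) by fastforce
    show "rich_lines q n \<subseteq> ?l ` ?D"
    proof
      fix L assume "L \<in> rich_lines q n"
      \<comment> \<open>A fibre of size 2 is nonempty, so the fibre count also yields
        surjectivity.\<close>
      from fibre[OF this] have "{z \<in> ?D. ?l z = L} \<noteq> {}"
        by (metis card.empty zero_neq_numeral)
      then show "L \<in> ?l ` ?D" by blast
    qed
  qed
  \<comment> \<open>Counts the pairs line by line.\<close>
  have "card ?D = (\<Sum>L\<in>?l ` ?D. card {z \<in> ?D. ?l z = L})"
    using sum.image_gen[OF fin, of "\<lambda>_. 1::nat" ?l] by simp
  also have "\<dots> = 2 * num_lines_ge q n"
    unfolding img using fibre by (simp add: num_lines_ge_def rich_lines_def)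
  finally have "2 * num_lines_ge q n = card (steps (q - 1) n) - card (steps q n)"
    using card_Diff_subset[OF _ sub] finite_subset[OF sub] finite_steps[of "q - 1" n] assms(3) by simp
  \<comment> \<open>Ensures that the subtraction of naturals above agrees with the real one.\<close>
  moreover have "card (steps q n) \<le> card (steps (q - 1) n)"
    using card_mono[OF _ sub] finite_steps[of "q - 1" n] assms(3) by simp
  ultimately have "2 * real (num_lines_ge q n) = real (card (steps (q - 1) n)) - real (card (steps q n))"
    by linarith
  then show ?thesis
    using gcd_sum_eq_card_steps[of "q - 1" n] gcd_sum_eq_card_steps[of q n] assms(3) by simp
qed

end
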